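(* For every small free wedge there exists a finite deterministic automaton that explores it using two pebbles.
   Context: The oriented grid $\mathbb{Z}\times\mathbb{Z}$ is embedded in the plane (nodes at integer points, edges between nodes at distance 1); nodes are anonymous and every node has ports $N,E,S,W$ pointing North, East, South, West. Given two half-lines $H_1,H_2$ in the plane with a common origin $O$ (arbitrary real directions), let $W(H_1,H_2)$ be the closed region swept clockwise from $H_1$ to $H_2$ (half-lines included); the wedge is the subgraph of the grid induced by the grid nodes in $W(H_1,H_2)$. It is small if the clockwise angle from $H_1$ to $H_2$ is less than $\pi$. A wedge is free if both boundaries are free, i.e., all ports at all nodes of the grid are free and the agent moves in the whole grid unrestricted, but must visit all nodes of the wedge; for free wedges the origin $O$ is the starting node of the agent. The agent is a finite deterministic (Mealy) automaton carrying $p$ pebbles: at each step it sees whether a pebble lies on the current node and how many pebbles it carries; depending on its state and this input it moves through a port, possibly dropping a pebble on the empty current node (if it carries one) or picking up the pebble lying there, and changes state. It starts in its initial state with all $p$ pebbles, with no pebbles on the grid. The automaton (which may depend on $H_1,H_2$) explores the wedge if every node of the wedge is eventually visited. *)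

theory Defs
  imports "HOL-Analysis.Analysis"
begin

type_synonym node = "int \<times> int"

definition node_point :: "node \<Rightarrow> complex" where
  "node_point v = Complex (real_of_int (fst v)) (real_of_int (snd v))"

text \<open>A half-line is given by its origin and a nonzero direction vector of arbitrary length.\<close>

definition halfline :: "complex \<Rightarrow> complex \<Rightarrow> complex set" where
  "halfline P d = {P + of_real t * d | t. 0 \<le> t}"

text \<open>
  The angle in \<open>[0, 2 * pi)\<close> by which \<open>d1\<close> has to be turned clockwise (i.e. in the
  mathematically negative sense) to point in the direction \<open>d2\<close>; it is 0 for equal directions.
\<close>

definition cw_angle :: "complex \<Rightarrow> complex \<Rightarrow> real" where
  "cw_angle d1 d2 = Arg2pi (d1 / d2)"

lemma cw_angle_range: "0 \<le> cw_angle d1 d2" "cw_angle d1 d2 < 2 * pi"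
  by (simp_all add: cw_angle_def Arg2pi_ge_0 Arg2pi_lt_2pi)

lemma sgn_cw_angle:
  assumes "d1 \<noteq> 0" "d2 \<noteq> 0"
  shows "sgn d2 = sgn d1 * cis (- cw_angle d1 d2)"
proof -
  have eq: "d1 / d2 = of_real (norm (d1 / d2)) * cis (cw_angle d1 d2)"
    using Arg2pi_eq[of "d1 / d2"] unfolding cw_angle_def cis_conv_exp by simp
  have "sgn (d1 / d2) = sgn (complex_of_real (norm (d1 / d2))) * sgn (cis (cw_angle d1 d2))"
    by (subst eq) (rule sgn_mult)
  also have "\<dots> = cis (cw_angle d1 d2)"
    using assms by (simp add: sgn_of_real)
  finally have "sgn d1 = sgn d2 * cis (cw_angle d1 d2)"
    using assms by (simp add: sgn_divide field_simps sgn_zero_iff)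
  then show ?thesis
    by (simp add: mult.assoc cis_mult)
qed

definition wedge_region :: "complex \<Rightarrow> complex \<Rightarrow> complex \<Rightarrow> complex set" where
  "wedge_region P d1 d2 = (\<Union>\<theta>\<in>{0..cw_angle d1 d2}. halfline P (d1 * cis (- \<theta>)))"

text \<open>
  The wedge is an induced subgraph, hence represented by its set of nodes. The origin of a free
  wedge is a grid node, namely the starting node of the agent.
\<close>

definition wedge :: "node \<Rightarrow> complex \<Rightarrow> complex \<Rightarrow> node set" where
  "wedge v0 d1 d2 = {v. node_point v \<in> wedge_region (node_point v0) d1 d2}"

definition small_wedge :: "complex \<Rightarrow> complex \<Rightarrow> bool" where
  "small_wedge d1 d2 \<longleftrightarrow> cw_angle d1 d2 < pi"

datatype port = North | East | South | West

fun neighbor :: "port \<Rightarrow> node \<Rightarrow> node" where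
  "neighbor North (x, y) = (x, y + 1)"
| "neighbor East (x, y) = (x + 1, y)"
| "neighbor South (x, y) = (x, y - 1)"
| "neighbor West (x, y) = (x - 1, y)"

datatype pebble_action = Keep | Drop | Pick

text \<open>
  The input consists of whether there is a pebble on the current node and of the number of
  pebbles carried. The free ports are not part of it, as in the free case all four of them are
  free at every node. Taking \<open>'s = nat\<close> loses no generality for finitely many states.
\<close>

record 's automaton =
  states :: "'s set"
  init :: 's
  next_state :: "'s \<Rightarrow> bool \<Rightarrow> nat \<Rightarrow> 's"
  action_port :: "'s \<Rightarrow> bool \<Rightarrow> nat \<Rightarrow> pebble_action \<times> port"

text \<open>
  With \<open>p\<close> pebbles in total, only the inputs with at most \<open>p\<close> carried pebbles matter. A pebble
  may only be dropped on an empty node by an agent carrying one, and only be picked up from a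
  node holding one.
\<close>

definition is_automaton :: "nat \<Rightarrow> 's automaton \<Rightarrow> bool" where
  "is_automaton p A \<longleftrightarrow>
     finite (states A) \<and> init A \<in> states A \<and>
     (\<forall>q\<in>states A. \<forall>b. \<forall>c\<le>p.
        next_state A q b c \<in> states A \<and>
        (fst (action_port A q b c) = Drop \<longrightarrow> \<not> b \<and> 0 < c) \<and>
        (fst (action_port A q b c) = Pick \<longrightarrow> b))"

record 's config =
  state :: 's
  position :: node
  pebbles :: "node set"
  carried :: nat

definition init_config :: "'s automaton \<Rightarrow> nat \<Rightarrow> node \<Rightarrow> 's config" where
  "init_config A p v0 = \<lparr>state = init A, position = v0, pebbles = {}, carried = p\<rparr>"

definition step :: "'s automaton \<Rightarrow> 's config \<Rightarrow> 's config" where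
  "step A C =
     (let q = state C; v = position C; b = (v \<in> pebbles C); c = carried C;
          (a, d) = action_port A q b c
      in \<lparr>state = next_state A q b c,
          position = neighbor d v,
          pebbles = (case a of Keep \<Rightarrow> pebbles C
                             | Drop \<Rightarrow> insert v (pebbles C)
                             | Pick \<Rightarrow> pebbles C - {v}),
          carried = (case a of Keep \<Rightarrow> c | Drop \<Rightarrow> c - 1 | Pick \<Rightarrow> c + 1)\<rparr>)"

definition run :: "'s automaton \<Rightarrow> nat \<Rightarrow> node \<Rightarrow> nat \<Rightarrow> 's config" where
  "run A p v0 t = (step A ^^ t) (init_config A p v0)"

definition explores :: "'s automaton \<Rightarrow> nat \<Rightarrow> node \<Rightarrow> node set \<Rightarrow> bool" where
  "explores A p v0 V \<longleftrightarrow> (\<forall>v\<in>V. \<exists>t. position (run A p v0 t) = v)"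

end

theory Submission
  imports Defs
begin

text \<open>
  The directions of a small wedge lie in an open rational half-plane, which allows to choose
  integer vectors \<open>u\<close>, \<open>w\<close> of determinant 1 whose cone contains the wedge. The grid nodes of this
  cone are the points \<open>v0 + i * u + j * w\<close> with natural numbers \<open>i\<close>, \<open>j\<close>. The agent keeps its
  pebbles at \<open>v0 + k * u\<close> and \<open>v0 + k * w\<close>: starting from the former it repeats the displacement
  \<open>w - u\<close>, which visits all points with \<open>i + j = k\<close>, until it sees the latter, moves that pebble
  on by \<open>w\<close>, returns along the same line and moves the first pebble on by \<open>u\<close>.
\<close>

section \<open>Automata with named states\<close>

text \<open>Lets the construction use pairs of a mode and a displacement as states. Renaming along
  \<open>to_nat\<close> commutes with \<open>step\<close>, so both runs visit the same
  nodes.\<close>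

lemma explores_nat_automaton:
  fixes A :: "'s::countable automaton"
  assumes "is_automaton p A" and "explores A p v0 V"
  shows "\<exists>B :: nat automaton. is_automaton p B \<and> explores B p v0 V"
proof -
  define B :: "nat automaton" where
    "B = \<lparr>states = to_nat ` states A, init = to_nat (init A),
          next_state = (\<lambda>q b c. to_nat (next_state A (from_nat q) b c)),
          action_port = (\<lambda>q. action_port A (from_nat q))\<rparr>"
  have "is_automaton p B"
    using assms(1) by (auto simp: B_def is_automaton_def)
  moreover
  define h where
    "h = (\<lambda>C :: 's config. \<lparr>state = to_nat (state C), position = position C,
                              pebbles = pebbles C, carried = carried C\<rparr>)"
  have "step B (h C) = h (step A C)" for C
    by (simp add: step_def h_def B_def Let_def split: prod.split pebble_action.split)
  moreover have "init_config B p v0 = h (init_config A p v0)"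
    by (simp add: init_config_def h_def B_def)
  ultimately have "run B p v0 t = h (run A p v0 t)" for t
    by (induction t) (simp_all add: run_def)
  then have "explores B p v0 V"
    using assms(2) by (simp add: explores_def h_def)
  with \<open>is_automaton p B\<close> show ?thesis by blast
qed

section \<open>Programs whose instructions are displacements\<close>

fun heading :: "node \<Rightarrow> port" where
  "heading (x, y) = (if 0 < x then East else if x < 0 then West else if 0 < y then North else South)"

text \<open>
  An instruction acts on the current node, then travels along a displacement. The second
  component of a state is the displacement still to be travelled. As every step of an automaton
  moves, an instruction always starts with a step to the East, which the remaining displacement
  compensates for.
\<close>

definition travel_box :: "node \<Rightarrow> node set" where
  "travel_box d = {- \<bar>fst d\<bar> - 1..\<bar>fst d\<bar> + 1} \<times> {- \<bar>snd d\<bar>..\<bar>snd d\<bar>}"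

text \<open>An illegal \<open>Drop\<close> or \<open>Pick\<close> is replaced by
  \<open>Keep\<close>, so that every program over finitely many modes yields an automaton.\<close>

definition walker ::
    "('m \<Rightarrow> bool \<Rightarrow> pebble_action \<times> node \<times> 'm) \<Rightarrow> 'm \<Rightarrow> ('m \<times> node) automaton" where
  "walker prog m0 =
     \<lparr>states = UNIV \<times> (\<Union>m. \<Union>b. travel_box (fst (snd (prog m b)))),
      init = (m0, 0),
      next_state = (\<lambda>(m, r) b c.
        if r = 0 then (case prog m b of (a, d, m') \<Rightarrow> (m', d - neighbor East 0))
        else (m, r - neighbor (heading r) 0)),
      action_port = (\<lambda>(m, r) b c.
        if r = 0 then (case prog m b of (a, d, m') \<Rightarrow>
          (if a = Drop \<and> (b \<or> c = 0) \<or> a = Pick \<and> \<not> b then Keep else a, East))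
        else (Keep, heading r))\<rparr>"

lemma neighbor_eq_add: "neighbor d v = v + neighbor d 0"
  by (cases d; cases v) (simp_all add: zero_prod_def)

lemma zero_in_travel_box: "0 \<in> travel_box d"
  by (simp add: travel_box_def mem_Times_iff)

text \<open>The margin of 1 in the first coordinate of \<open>travel_box\<close> makes room for
  compensating the initial step to the East.\<close>

lemma travel_box_start: "d - neighbor East 0 \<in> travel_box d"
  by (cases d) (auto simp: travel_box_def zero_prod_def)

lemma travel_box_step: "r \<in> travel_box d \<Longrightarrow> r \<noteq> 0 \<Longrightarrow> r - neighbor (heading r) 0 \<in> travel_box d"
  by (cases r) (auto simp: travel_box_def zero_prod_def)

lemma is_automaton_walker:
  fixes prog :: "'m::finite \<Rightarrow> bool \<Rightarrow> pebble_action \<times> node \<times> 'm"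
  shows "is_automaton p (walker prog m0)"
proof -
  let ?A = "walker prog m0"
  have "finite (states ?A)"
    by (simp add: walker_def travel_box_def)
  moreover have "init ?A \<in> states ?A"
    by (auto simp: walker_def zero_in_travel_box)
  moreover have "next_state ?A (m, r) b c \<in> states ?A" if mem: "(m, r) \<in> states ?A" for m r b c
  proof (cases "r = 0")
    case True
    obtain a d m' where "prog m b = (a, d, m')"
      by (cases "prog m b")
    then have "\<exists>m b. d - neighbor East 0 \<in> travel_box (fst (snd (prog m b)))"
      using travel_box_start by (intro exI[of _ m] exI[of _ b]) simp
    then show ?thesis
      using True \<open>prog m b = _\<close> by (auto simp: walker_def simp del: neighbor.simps)
  next
    case False
    obtain m1 b1 where "r \<in> travel_box (fst (snd (prog m1 b1)))"
      using mem by (auto simp: walker_def)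
    then have "\<exists>m b. r - neighbor (heading r) 0 \<in> travel_box (fst (snd (prog m b)))"
      using False travel_box_step by blast
    then show ?thesis
      using False by (auto simp: walker_def)
  qed
  moreover have
    "(fst (action_port ?A (m, r) b c) = Drop \<longrightarrow> \<not> b \<and> 0 < c) \<and>
     (fst (action_port ?A (m, r) b c) = Pick \<longrightarrow> b)" for m r b c
    by (auto simp: walker_def split: prod.splits)
  ultimately show ?thesis
    unfolding is_automaton_def by (metis surj_pair)
qed

section \<open>Reachability between configurations and the effect of single instructions\<close>

definition reaches :: "'s automaton \<Rightarrow> 's config \<Rightarrow> 's config \<Rightarrow> bool" where
  "reaches A C C' \<longleftrightarrow> (\<exists>t. (step A ^^ t) C = C')"

lemma reaches_refl: "reaches A C C"
  unfolding reaches_def by (rule exI[of _ 0]) simp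

lemma reaches_step: "reaches A (step A C) C' \<Longrightarrow> reaches A C C'"
  unfolding reaches_def by (metis comp_apply funpow_Suc_right)

lemma reaches_trans [trans]: "reaches A C C' \<Longrightarrow> reaches A C' C'' \<Longrightarrow> reaches A C C''"
  unfolding reaches_def by (metis comp_apply funpow_add)

definition conf :: "'m \<Rightarrow> node \<Rightarrow> node set \<Rightarrow> nat \<Rightarrow> ('m \<times> node) config" where
  "conf m v P c = \<lparr>state = (m, 0), position = v, pebbles = P, carried = c\<rparr>"

text \<open>Each step along \<open>heading\<close> shortens the remaining displacement by 1 in the
  sum norm. Pebbles met on the way have no effect, since the input is consulted only when nothing
  remains to be travelled.\<close>

lemma walker_travel:
  "reaches (walker prog m0) \<lparr>state = (m, r), position = v, pebbles = P, carried = c\<rparr>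
     (conf m (v + r) P c)"
proof (induction "nat \<bar>fst r\<bar> + nat \<bar>snd r\<bar>" arbitrary: r v rule: less_induct)
  case less
  let ?e = "neighbor (heading r) 0"
  show ?case
  proof (cases "r = 0")
    case True
    then show ?thesis by (simp add: conf_def reaches_refl)
  next
    case False
    then have "nat \<bar>fst (r - ?e)\<bar> + nat \<bar>snd (r - ?e)\<bar> < nat \<bar>fst r\<bar> + nat \<bar>snd r\<bar>"
      by (cases r) (auto simp: zero_prod_def)
    from less[OF this, of "v + ?e"] show ?thesis
      using False
      by - (rule reaches_step, simp add: step_def walker_def neighbor_eq_add[of _ v])
  qed
qed

lemma walker_keep:
  assumes "v \<notin> P" "prog m False = (Keep, d, m')" "v' = v + d"
  shows "reaches (walker prog m0) (conf m v P c) (conf m' v' P c)"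
  using walker_travel[of prog m0 m' "d - neighbor East 0" "v + neighbor East 0" "P" "c"]
    assms
  by - (rule reaches_step, simp add: step_def conf_def walker_def neighbor_eq_add[of _ v])

lemma walker_drop:
  assumes "v \<notin> P" "prog m False = (Drop, d, m')" "v' = v + d" "P' = insert v P"
  shows "reaches (walker prog m0) (conf m v P (Suc c)) (conf m' v' P' c)"
  using walker_travel[of prog m0 m' "d - neighbor East 0" "v + neighbor East 0" "insert v P" "c"]
    assms
  by - (rule reaches_step, simp add: step_def conf_def walker_def neighbor_eq_add[of _ v])

lemma walker_pick:
  assumes "v \<in> P" "prog m True = (Pick, d, m')" "v' = v + d" "P' = P - {v}"
  shows "reaches (walker prog m0) (conf m v P c) (conf m' v' P' (Suc c))"
  using walker_travel[of prog m0 m' "d - neighbor East 0" "v + neighbor East 0" "P - {v}" "Suc c"]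
    assms
  by - (rule reaches_step, simp add: step_def conf_def walker_def neighbor_eq_add[of _ v])

section \<open>Sweeping a unimodular cone\<close>

datatype mode = Start | Plant | Base | Out | Push | Back

instance mode :: finite
proof
  have "m \<in> {Start, Plant, Base, Out, Push, Back}" for m
    by (cases m) auto
  then show "finite (UNIV :: mode set)"
    by (metis finite.emptyI finite.insertI finite_subset subsetI)
qed

text \<open>\<open>Start\<close> and \<open>Plant\<close> put the first pebble at offset
  \<open>w\<close> from the origin and lead to offset \<open>u\<close>. \<open>Base\<close> and
  \<open>Push\<close> are the turning points on the \<open>u\<close> side and on the
  \<open>w\<close> side. After \<open>Push\<close>, the displacement \<open>u - w - w\<close> undoes
  the extra \<open>w\<close> and makes the first move of the way back.\<close>

fun sweep :: "node \<Rightarrow> node \<Rightarrow> mode \<Rightarrow> bool \<Rightarrow> pebble_action \<times> node \<times> mode" where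
  "sweep u w Start b = (Keep, w, Plant)"
| "sweep u w Plant b = (Drop, u - w, Base)"
| "sweep u w Base b = (Drop, w - u, Out)"
| "sweep u w Out True = (Pick, w, Push)"
| "sweep u w Out False = (Keep, w - u, Out)"
| "sweep u w Push b = (Drop, u - w - w, Back)"
| "sweep u w Back True = (Pick, u, Base)"
| "sweep u w Back False = (Keep, u - w, Back)"

locale cone =
  fixes v0 :: node and ux uy wx wy :: int
  assumes det: "ux * wy - uy * wx = 1"
begin

definition pt :: "nat \<Rightarrow> nat \<Rightarrow> node" where
  "pt i j = v0 + (int i * ux + int j * wx, int i * uy + int j * wy)"

definition u :: node where "u = (ux, uy)"

definition w :: node where "w = (wx, wy)"

definition A :: "(mode \<times> node) automaton" where
  "A = walker (sweep u w) Start"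

text \<open>Cramer's rule with determinant 1. The sweep lemmas use it to decide whether the current
  node holds a pebble.\<close>

lemma pt_eq_iff [simp]: "pt i j = pt i' j' \<longleftrightarrow> i = i' \<and> j = j'"
proof
  assume "pt i j = pt i' j'"
  then have x: "int i * ux + int j * wx = int i' * ux + int j' * wx"
    and y: "int i * uy + int j * wy = int i' * uy + int j' * wy"
    by (simp_all add: pt_def)
  have "int i = int i'"
    using x y det by algebra
  moreover have "int j = int j'"
    using x y det by algebra
  ultimately show "i = i' \<and> j = j'" by simp
qed simp

lemma pt_0_0: "pt 0 0 = v0"
  by (simp add: pt_def prod_eq_iff)

lemma pt_move:
  "pt i j + u = pt (Suc i) j"
  "pt i j + w = pt i (Suc j)"
  "pt (Suc i) j + (w - u) = pt i (Suc j)"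
  "pt i (Suc j) + (u - w) = pt (Suc i) j"
  "pt i (Suc (Suc j)) + (u - w - w) = pt (Suc i) j"
  unfolding pt_def u_def w_def prod_eq_iff fst_add snd_add fst_diff snd_diff fst_conv snd_conv
    of_nat_Suc
  by algebra+

lemma reaches_keep:
  assumes "v \<notin> P" "sweep u w m False = (Keep, d, m')" "v' = v + d"
  shows "reaches A (conf m v P c) (conf m' v' P c)"
  unfolding A_def by (rule walker_keep[where prog = "sweep u w", OF assms])

lemma reaches_drop:
  assumes "v \<notin> P" "sweep u w m False = (Drop, d, m')" "v' = v + d" "P' = insert v P"
  shows "reaches A (conf m v P (Suc c)) (conf m' v' P' c)"
  unfolding A_def by (rule walker_drop[where prog = "sweep u w", OF assms])

lemma reaches_pick:
  assumes "v \<in> P" "sweep u w m True = (Pick, d, m')" "v' = v + d" "P' = P - {v}"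
  shows "reaches A (conf m v P c) (conf m' v' P' (Suc c))"
  unfolding A_def by (rule walker_pick[where prog = "sweep u w", OF assms])

text \<open>The index is shifted: sweep \<open>k\<close> covers the line
  \<open>i + j = k + 1\<close>, since the line \<open>i + j = 0\<close> is just the starting
  node.\<close>

definition sweep_start :: "nat \<Rightarrow> (mode \<times> node) config" where
  "sweep_start k = conf Base (pt (Suc k) 0) {pt 0 (Suc k)} (Suc 0)"

lemma reaches_first_sweep: "reaches A (conf Start v0 {} (Suc (Suc 0))) (sweep_start 0)"
proof -
  have "reaches A (conf Start v0 {} (Suc (Suc 0))) (conf Plant (pt 0 1) {} (Suc (Suc 0)))"
    using pt_move(2)[of 0 0]
    by (intro reaches_keep[OF _ sweep.simps(1)]) (simp_all add: pt_0_0)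
  also have "reaches A \<dots> (sweep_start 0)"
    unfolding sweep_start_def
    by (rule reaches_drop[OF _ sweep.simps(2)]) (simp_all add: pt_move)
  finally show ?thesis .
qed

text \<open>Both pebbles lie on the axes of the cone, so a node with two positive coordinates holds
  none and \<open>Out\<close> goes on.\<close>

lemma reaches_out:
  "i + j = k \<Longrightarrow>
   reaches A (sweep_start k) (conf Out (pt i (Suc j)) {pt (Suc k) 0, pt 0 (Suc k)} 0)"
proof (induction j arbitrary: i)
  case 0
  then show ?case
    unfolding sweep_start_def
    by (intro reaches_drop[OF _ sweep.simps(3)]) (simp_all add: pt_move)
next
  case (Suc j)
  let ?P = "{pt (Suc k) 0, pt 0 (Suc k)}"
  have "reaches A (sweep_start k) (conf Out (pt (Suc i) (Suc j)) ?P 0)"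
    using Suc by simp
  also have "reaches A \<dots> (conf Out (pt i (Suc (Suc j))) ?P 0)"
    by (rule reaches_keep[OF _ sweep.simps(5)]) (simp_all add: pt_move)
  finally show ?case .
qed

text \<open>As on the way out, nodes with two positive coordinates hold no pebble; the pushed pebble
  has left the line, and only the one at \<open>pt (Suc k) 0\<close> can end the way back.\<close>

lemma reaches_back:
  "i + j = k \<Longrightarrow>
   reaches A (conf Back (pt 1 k) {pt (Suc k) 0, pt 0 (Suc (Suc k))} 0)
     (conf Back (pt (Suc i) j) {pt (Suc k) 0, pt 0 (Suc (Suc k))} 0)"
proof (induction i arbitrary: j)
  case 0
  then show ?case by (simp add: reaches_refl)
next
  case (Suc i)
  let ?P = "{pt (Suc k) 0, pt 0 (Suc (Suc k))}"
  have "reaches A (conf Back (pt 1 k) ?P 0) (conf Back (pt (Suc i) (Suc j)) ?P 0)"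
    using Suc by simp
  also have "reaches A \<dots> (conf Back (pt (Suc (Suc i)) j) ?P 0)"
    by (rule reaches_keep[OF _ sweep.simps(8)]) (simp_all add: pt_move)
  finally show ?case .
qed

lemma reaches_next_sweep: "reaches A (sweep_start k) (sweep_start (Suc k))"
proof -
  let ?P = "{pt (Suc k) 0, pt 0 (Suc (Suc k))}"
  have "reaches A (sweep_start k) (conf Out (pt 0 (Suc k)) {pt (Suc k) 0, pt 0 (Suc k)} 0)"
    by (rule reaches_out) simp
  also have "reaches A \<dots> (conf Push (pt 0 (Suc (Suc k))) {pt (Suc k) 0} (Suc 0))"
    by (rule reaches_pick[OF _ sweep.simps(4)]) (simp_all add: pt_move insert_Diff_if)
  \<comment> \<open>For \<open>k = 0\<close> this node is already the one holding the base pebble,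
    and the way back is empty.\<close>
  also have "reaches A \<dots> (conf Back (pt 1 k) ?P 0)"
    by (rule reaches_drop[OF _ sweep.simps(6)]) (simp_all add: pt_move insert_commute)
  also have "reaches A \<dots> (conf Back (pt (Suc k) 0) ?P 0)"
    by (rule reaches_back) simp
  also have "reaches A \<dots> (sweep_start (Suc k))"
    unfolding sweep_start_def
    by (rule reaches_pick[OF _ sweep.simps(7)]) (simp_all add: pt_move insert_Diff_if)
  finally show ?thesis .
qed

lemma reaches_sweep: "reaches A (conf Start v0 {} (Suc (Suc 0))) (sweep_start k)"
proof (induction k)
  case 0
  show ?case by (rule reaches_first_sweep)
next
  case (Suc k)
  then show ?case using reaches_next_sweep by (rule reaches_trans)
qed

lemma visits_pt: "\<exists>t. position (run A 2 v0 t) = pt i j"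
proof -
  let ?I = "conf Start v0 {} (Suc (Suc 0))"
  have "\<exists>C. reaches A ?I C \<and> position C = pt i j"
  proof (cases j)
    case 0
    show ?thesis
    proof (cases i)
      case 0
      with \<open>j = 0\<close> show ?thesis
        by (intro exI[of _ ?I]) (simp add: reaches_refl conf_def pt_0_0)
    next
      case (Suc k)
      with \<open>j = 0\<close> show ?thesis
        by (intro exI[of _ "sweep_start k"] conjI reaches_sweep) (simp add: sweep_start_def conf_def)
    qed
  next
    case (Suc l)
    \<comment> \<open>A node with \<open>j = Suc l\<close> lies on the line of sweep
      \<open>i + l\<close> and is met in mode \<open>Out\<close>.\<close>
    have "reaches A ?I (conf Out (pt i j) {pt (Suc (i + l)) 0, pt 0 (Suc (i + l))} 0)"
      unfolding Suc by (rule reaches_trans[OF reaches_sweep reaches_out[OF refl]])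
    then show ?thesis
      by - (rule exI, rule conjI, assumption, simp add: conf_def)
  qed
  moreover have "init_config A 2 v0 = ?I"
    by (simp add: init_config_def conf_def A_def walker_def)
  ultimately show ?thesis
    by (auto simp: reaches_def run_def)
qed

end

section \<open>Small wedges lie in unimodular cones\<close>

text \<open>Rounding \<open>N * m\<close> to integers changes its inner product with
  \<open>d\<close> by a bounded amount, while \<open>N * (m \<bullet> d)\<close> tends to infinity.
  So a large \<open>N\<close> serves both directions, and dividing by the gcd keeps the
  signs.\<close>

lemma integer_functional_pos:
  fixes m d1 d2 :: complex
  assumes "0 < m \<bullet> d1" "0 < m \<bullet> d2"
  obtains p q :: int where "coprime p q"
    "0 < of_int p * Re d1 + of_int q * Im d1" "0 < of_int p * Re d2 + of_int q * Im d2"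
proof -
  have floor_pos: "\<forall>\<^sub>F N in sequentially.
      0 < of_int \<lfloor>real N * Re m\<rfloor> * Re d + of_int \<lfloor>real N * Im m\<rfloor> * Im d"
    if "0 < m \<bullet> d" for d
  proof -
    have "filterlim (\<lambda>N. real N * (m \<bullet> d)) at_top sequentially"
      using that by (intro filterlim_at_top_mult_tendsto_pos[OF tendsto_const]
          filterlim_real_sequentially)
    then have "\<forall>\<^sub>F N in sequentially. \<bar>Re d\<bar> + \<bar>Im d\<bar> < real N * (m \<bullet> d)"
      by (simp add: filterlim_at_top_dense)
    then show ?thesis
    proof eventually_elim
      case (elim N)
      \<comment> \<open>Summed over the two coordinates, the rounding error is at most
        \<open>\<bar>Re d\<bar> + \<bar>Im d\<bar>\<close>.\<close>
      have err: "(x - of_int \<lfloor>x\<rfloor>) * y \<le> \<bar>y\<bar>" for x y :: real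
      proof -
        have "\<bar>(x - of_int \<lfloor>x\<rfloor>) * y\<bar> \<le> 1 * \<bar>y\<bar>"
          unfolding abs_mult by (intro mult_right_mono) linarith+
        then show ?thesis by linarith
      qed
      show ?case
        using elim err[of "real N * Re m" "Re d"] err[of "real N * Im m" "Im d"]
        by (simp add: inner_complex_def algebra_simps)
    qed
  qed
  obtain N :: nat where N:
    "0 < of_int \<lfloor>real N * Re m\<rfloor> * Re d1 + of_int \<lfloor>real N * Im m\<rfloor> * Im d1"
    "0 < of_int \<lfloor>real N * Re m\<rfloor> * Re d2 + of_int \<lfloor>real N * Im m\<rfloor> * Im d2"
    using eventually_happens'[OF _ eventually_conj[OF floor_pos[OF assms(1)] floor_pos[OF assms(2)]]]
    by auto
  define p q where "p = \<lfloor>real N * Re m\<rfloor>" and "q = \<lfloor>real N * Im m\<rfloor>"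
  have "p \<noteq> 0 \<or> q \<noteq> 0"
    using N by (auto simp: p_def q_def)
  then obtain p' q' where g: "p = p' * gcd p q" "q = q' * gcd p q" "coprime p' q'"
    by (metis gcd_coprime_exists gcd_eq_0_iff)
  have "0 < gcd p q"
    using \<open>p \<noteq> 0 \<or> q \<noteq> 0\<close> by simp
  have "0 < of_int p' * x + of_int q' * y" if "0 < of_int p * x + of_int q * y" for x y :: real
  proof -
    have "of_int p * x + of_int q * y = of_int (gcd p q) * (of_int p' * x + of_int q' * y)"
      by (subst (1) g(1), subst (2) g(2)) (simp add: algebra_simps)
    with that \<open>0 < gcd p q\<close> show ?thesis
      by (simp add: zero_less_mult_iff)
  qed
  with N g(3) that show ?thesis
    by (simp add: p_def q_def)
qed

text \<open>The vector \<open>u = (q, - p)\<close> spans the boundary of the half-plane where the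
  functional \<open>(p, q)\<close> is nonnegative. With a Bezout vector \<open>(s, t)\<close>, the
  vector \<open>w = (s, t) - n * u\<close> keeps the determinant 1 and turns towards
  \<open>- u\<close> as \<open>n\<close> grows, so the cone finally contains both
  directions.\<close>

lemma unimodular_cone:
  fixes d1 d2 :: complex
  assumes "0 < m \<bullet> d1" "0 < m \<bullet> d2"
  obtains ux uy wx wy :: int where "ux * wy - uy * wx = 1"
    "\<And>d. d \<in> {d1, d2} \<Longrightarrow> 0 \<le> of_int wy * Re d - of_int wx * Im d"
    "\<And>d. d \<in> {d1, d2} \<Longrightarrow> 0 \<le> of_int ux * Im d - of_int uy * Re d"
proof -
  obtain p q :: int where pq: "coprime p q"
    "0 < of_int p * Re d1 + of_int q * Im d1" "0 < of_int p * Re d2 + of_int q * Im d2"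
    using integer_functional_pos[OF assms] .
  obtain s t :: int where st: "s * p + t * q = 1"
    using bezout_int[of p q] pq(1) by auto
  have large: "\<exists>N::nat. \<forall>n\<ge>N. 0 \<le> y + real n * x" if pos: "0 < x" for x y :: real
  proof -
    obtain N :: nat where N: "- y < real N * x"
      using reals_Archimedean3[OF pos] by blast
    have "0 \<le> y + real n * x" if "n \<ge> N" for n
    proof -
      have "real N * x \<le> real n * x"
        using \<open>0 < x\<close> that by simp
      with N show ?thesis by linarith
    qed
    then show ?thesis by blast
  qed
  obtain N1 N2 :: nat where
    N1: "\<And>n. n \<ge> N1 \<Longrightarrow> 0 \<le> (of_int t * Re d1 - of_int s * Im d1)
            + real n * (of_int p * Re d1 + of_int q * Im d1)" and
    N2: "\<And>n. n \<ge> N2 \<Longrightarrow> 0 \<le> (of_int t * Re d2 - of_int s * Im d2)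
            + real n * (of_int p * Re d2 + of_int q * Im d2)"
    using large[OF pq(2)] large[OF pq(3)] by metis
  define n where "n = max N1 N2"
  show ?thesis
  \<comment> \<open>The instances are in the order \<open>ux\<close>, \<open>wy\<close>,
    \<open>uy\<close>, \<open>wx\<close>, in which the variables occur in the determinant.\<close>
  proof (rule that[of q "t + int n * p" "- p" "s - int n * q"])
    show "q * (t + int n * p) - - p * (s - int n * q) = 1"
      using st by (simp add: algebra_simps)
    show "0 \<le> of_int (t + int n * p) * Re d - of_int (s - int n * q) * Im d"
      if "d \<in> {d1, d2}" for d
      using that N1[of n] N2[of n] by (auto simp: n_def algebra_simps)
    show "0 \<le> of_int q * Im d - of_int (- p) * Re d" if "d \<in> {d1, d2}" for d
      using that pq by auto
  qed
qed

section \<open>Trigonometry of small wedges\<close>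

lemma polar_cw_angle:
  assumes "d1 \<noteq> 0" "d2 \<noteq> 0"
  shows "d1 = of_real (norm d1) * cis (Arg d1)"
    and "d2 = of_real (norm d2) * cis (Arg d1 - cw_angle d1 d2)"
proof -
  show "d1 = of_real (norm d1) * cis (Arg d1)"
    using rcis_cmod_Arg[of d1] by (simp add: rcis_def)
  have "sgn d2 = cis (Arg d1) * cis (- cw_angle d1 d2)"
    using sgn_cw_angle[OF assms] cis_Arg[OF assms(1)] by simp
  then have "sgn d2 = cis (Arg d1 - cw_angle d1 d2)"
    by (simp add: cis_mult)
  moreover have "d2 = of_real (norm d2) * sgn d2"
    using assms(2) by (simp add: sgn_eq)
  ultimately show "d2 = of_real (norm d2) * cis (Arg d1 - cw_angle d1 d2)"
    by simp
qed

text \<open>The bisector of the wedge encloses an angle of \<open>\<alpha> / 2 < pi / 2\<close> with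
  either boundary.\<close>

lemma small_wedge_bisector:
  assumes "d1 \<noteq> 0" "d2 \<noteq> 0" "small_wedge d1 d2"
  obtains m where "0 < m \<bullet> d1" "0 < m \<bullet> d2"
proof -
  define \<alpha> \<beta> where "\<alpha> = cw_angle d1 d2" and "\<beta> = Arg d1"
  have "0 \<le> \<alpha>" "\<alpha> < pi"
    using assms(3) cw_angle_range by (auto simp: \<alpha>_def small_wedge_def)
  then have "0 < cos (\<alpha> / 2)"
    by (intro cos_gt_zero_pi) auto
  have inner: "cis x \<bullet> (of_real r * cis y) = r * cos (x - y)" for x y r
    by (simp add: inner_complex_def cos_diff algebra_simps)
  show ?thesis
  proof (rule that[of "cis (\<beta> - \<alpha> / 2)"])
    show "0 < cis (\<beta> - \<alpha> / 2) \<bullet> d1"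
      using \<open>0 < cos (\<alpha> / 2)\<close> assms(1)
      by (subst polar_cw_angle(1)[OF assms(1,2)]) (simp add: inner \<beta>_def)
    show "0 < cis (\<beta> - \<alpha> / 2) \<bullet> d2"
      using \<open>0 < cos (\<alpha> / 2)\<close> assms(2)
      by (subst polar_cw_angle(2)[OF assms(1,2)]) (simp add: inner \<alpha>_def \<beta>_def)
  qed
qed

text \<open>Every direction inside a small wedge is a nonnegative combination of the two boundary
  directions, so a linear functional that is nonnegative on these is nonnegative on the whole
  region.\<close>

lemma wedge_functional_nonneg:
  fixes a b :: real
  assumes "d1 \<noteq> 0" "d2 \<noteq> 0" "small_wedge d1 d2"
    and nonneg: "0 \<le> a * Re d1 + b * Im d1" "0 \<le> a * Re d2 + b * Im d2"
    and "z \<in> wedge_region 0 d1 d2"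
  shows "0 \<le> a * Re z + b * Im z"
proof -
  define \<alpha> \<beta> where "\<alpha> = cw_angle d1 d2" and "\<beta> = Arg d1"
  define f where "f = (\<lambda>z. a * Re z + b * Im z)"
  have f_scale: "f (of_real r * z) = r * f z" for r z
    by (simp add: f_def algebra_simps)
  have "0 \<le> \<alpha>" "\<alpha> < pi"
    using assms(3) cw_angle_range by (auto simp: \<alpha>_def small_wedge_def)
  have "f d1 = norm d1 * f (cis \<beta>)" "f d2 = norm d2 * f (cis (\<beta> - \<alpha>))"
    using polar_cw_angle[OF assms(1,2), THEN arg_cong, of f]
    by (simp_all only: f_scale \<alpha>_def \<beta>_def)
  moreover have "0 \<le> f d1" "0 \<le> f d2"
    using nonneg by (simp_all add: f_def)
  ultimately have f1: "0 \<le> f (cis \<beta>)" and f2: "0 \<le> f (cis (\<beta> - \<alpha>))"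
    using assms(1,2) by (simp_all add: zero_le_mult_iff)
  obtain t \<theta> where t: "0 \<le> t" "0 \<le> \<theta>" "\<theta> \<le> \<alpha>" and z: "z = of_real t * (d1 * cis (- \<theta>))"
    using assms(6) by (auto simp: wedge_region_def halfline_def \<alpha>_def)
  have f_\<theta>: "0 \<le> f (cis (\<beta> - \<theta>))"
  proof (cases "\<alpha> = 0")
    case True
    with t f1 show ?thesis by simp
  next
    case False
    with \<open>0 \<le> \<alpha>\<close> \<open>\<alpha> < pi\<close> have "0 < sin \<alpha>"
      by (intro sin_gt_zero) auto
    \<comment> \<open>These are the two coordinates of the combination; its coefficients are
      nonnegative because \<open>0 \<le> \<theta> \<le> \<alpha> < pi\<close>. Dividing by
      \<open>sin \<alpha>\<close> is why \<open>\<alpha> = 0\<close> is treated apart.\<close>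
    have "sin \<alpha> * cos (\<beta> - \<theta>) = sin (\<alpha> - \<theta>) * cos \<beta> + sin \<theta> * cos (\<beta> - \<alpha>)"
      and "sin \<alpha> * sin (\<beta> - \<theta>) = sin (\<alpha> - \<theta>) * sin \<beta> + sin \<theta> * sin (\<beta> - \<alpha>)"
      by (simp_all add: sin_diff cos_diff algebra_simps)
    then have "sin \<alpha> * f (cis (\<beta> - \<theta>)) = sin (\<alpha> - \<theta>) * f (cis \<beta>) + sin \<theta> * f (cis (\<beta> - \<alpha>))"
      unfolding f_def by (simp, algebra)
    also have "\<dots> \<ge> 0"
      using f1 f2 t \<open>\<alpha> < pi\<close> by (intro add_nonneg_nonneg mult_nonneg_nonneg sin_ge_zero) auto
    finally show ?thesis
      using \<open>0 < sin \<alpha>\<close> by (simp add: zero_le_mult_iff)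
  qed
  have "z = of_real t * (of_real (norm d1) * cis (\<beta> - \<theta>))"
    using z polar_cw_angle(1)[OF assms(1,2)]
    by (metis \<beta>_def cis_mult mult.assoc uminus_add_conv_diff add.commute)
  then have "f z = t * (norm d1 * f (cis (\<beta> - \<theta>)))"
    by (simp only: f_scale)
  then show ?thesis
    using t f_\<theta> by (simp add: f_def)
qed

lemma wedge_region_shift: "z \<in> wedge_region P d1 d2 \<longleftrightarrow> z - P \<in> wedge_region 0 d1 d2"
  by (auto simp: wedge_region_def halfline_def algebra_simps)

theorem theorem4:
  fixes v0 :: node and d1 d2 :: complex
  assumes "d1 \<noteq> 0" and "d2 \<noteq> 0"
    and "small_wedge d1 d2"
  shows "\<exists>A :: nat automaton. is_automaton 2 A \<and> explores A 2 v0 (wedge v0 d1 d2)"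
proof -
  obtain m where "0 < m \<bullet> d1" "0 < m \<bullet> d2"
    using small_wedge_bisector[OF assms] .
  then obtain ux uy wx wy :: int where det: "ux * wy - uy * wx = 1"
    and wedge_w: "\<And>d. d \<in> {d1, d2} \<Longrightarrow> 0 \<le> of_int wy * Re d - of_int wx * Im d"
    and wedge_u: "\<And>d. d \<in> {d1, d2} \<Longrightarrow> 0 \<le> of_int ux * Im d - of_int uy * Re d"
    by (rule unimodular_cone) blast
  interpret cone v0 ux uy wx wy
    by standard (rule det)
  have "explores A 2 v0 (wedge v0 d1 d2)"
    unfolding explores_def
  proof
    fix v
    assume "v \<in> wedge v0 d1 d2"
    then have region: "node_point v - node_point v0 \<in> wedge_region 0 d1 d2"
      by (simp add: wedge_def flip: wedge_region_shift)
    define x y where "x = fst v - fst v0" and "y = snd v - snd v0"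
    have "0 \<le> real_of_int wy * x + - real_of_int wx * y"
      using wedge_functional_nonneg[OF assms _ _ region, of "of_int wy" "- of_int wx"] wedge_w
      by (simp add: node_point_def x_def y_def)
    then have i: "0 \<le> wy * x - wx * y"
      by (simp flip: of_int_mult)
    have "0 \<le> - real_of_int uy * x + real_of_int ux * y"
      using wedge_functional_nonneg[OF assms _ _ region, of "- of_int uy" "of_int ux"] wedge_u
      by (simp add: node_point_def x_def y_def)
    then have j: "0 \<le> ux * y - uy * x"
      by (simp flip: of_int_mult)
    \<comment> \<open>Determinant 1 makes the inverse matrix integral, so the cone coordinates of a
      grid node are integers; the functionals above show that they are nonnegative.\<close>
    have "x = (wy * x - wx * y) * ux + (ux * y - uy * x) * wx"
      "y = (wy * x - wx * y) * uy + (ux * y - uy * x) * wy"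
      using det by algebra+
    then have "v = pt (nat (wy * x - wx * y)) (nat (ux * y - uy * x))"
      using i j by (simp add: pt_def prod_eq_iff x_def y_def)
    then show "\<exists>t. position (run A 2 v0 t) = v"
      using visits_pt by simp
  qed
  moreover have "is_automaton 2 A"
    unfolding A_def by (rule is_automaton_walker)
  ultimately show ?thesis
    using explores_nat_automaton by blast
qed

end
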